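(* Let $p,q,r$ be three distinct almost collinear points in $\mathbb{R}^*\mathbb{P}^2$ and let $M\in\mathrm{GL}_3(\mathbb{R}^* )$ be non-singular (in the non-standard sense that the determinant of an appreciable representative of $M$ is appreciable). Then the transformed points $Mp,Mq,Mr$ are also almost collinear.
   Context: $\mathbb{R}^*$ denotes the hyperreal numbers, $\mathbb{I}$ the set of infinitesimal numbers. A number $r$ is appreciable if $1/n<|r|<n$ for some $n\in\mathbb{N}$; $\mathbb{A}$ is the set of appreciable numbers. Points and lines of $\mathbb{R}^*\mathbb{P}^2$ are both given by elements of $((\mathbb{R}^* )^3\setminus\{0\})/(\mathbb{R}^*\setminus\{0\})$. $\|\cdot\|$ is the Euclidean norm on vectors and the Frobenius norm on matrices. For nonzero $r$, $\mathbf{mag}(r)=\{s\neq 0 : \exists A\in\mathbb{A},\ r=A s\}$. An appreciable representative of a point or line $x$ is $x_{\mathbb{A}}=\lambda^{-1}x$ with $\lambda\in\mathbf{mag}(\|x\|)$. An appreciable representative of a nonzero matrix $M$ is $M_{\mathbb{A}}=\lambda^{-1}M$ with $\lambda\in\mathbf{mag}(\|M\|)$. $M$ is non-singular if $\det(M_{\mathbb{A}})$ is appreciable. For points $y,z$, $\mathbf{join}_*(y,z)=y_{\mathbb{A}}\times z_{\mathbb{A}}$ (cross product). Three points $x,y,z$ are almost collinear if $x$ is almost incident to the line $l:=\mathbf{join}_*(y,z)$, i.e. $\langle x_{\mathbb{A}},l_{\mathbb{A}}\rangle\in\mathbb{I}$, where $\langle\cdot,\cdot\rangle$ is the standard scalar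 product and $l_{\mathbb{A}}$ is an appreciable representative of $l$. *)

theory Defs
  imports "HOL-Analysis.Analysis"
begin

section \<open>A free ultrafilter on the natural numbers\<close>

definition free_ultrafilter :: "nat filter \<Rightarrow> bool" where
  "free_ultrafilter U \<longleftrightarrow> U \<noteq> bot \<and> U \<le> cofinite \<and>
     (\<forall>P. eventually P U \<or> eventually (\<lambda>n. \<not> P n) U)"

lemma ex_free_ultrafilter: "\<exists>U. free_ultrafilter U"
proof -
  let ?A = "{F :: nat filter. F \<noteq> bot \<and> F \<le> cofinite}"
  let ?R = "\<lambda>F G :: nat filter. G \<le> F"
  have cof: "(cofinite :: nat filter) \<in> ?A"
    by (simp add: trivial_limit_sequentially flip: cofinite_eq_sequentially)
  have po: "partial_order_on ?A (relation_of ?R ?A)"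
    by (rule partial_order_on_relation_ofI) auto
  have "\<exists>U\<in>?A. \<forall>F\<in>?A. ?R U F \<longrightarrow> F = U"
  proof (rule predicate_Zorn[OF po])
    fix C assume C: "C \<in> Chains (relation_of ?R ?A)"
    then have CA: "C \<subseteq> ?A"
      by (auto simp: Chains_def relation_of_def)
    have lin: "F \<le> G \<or> G \<le> F" if "F \<in> C" "G \<in> C" for F G
      using C that by (auto simp: Chains_def relation_of_def)
    show "\<exists>U\<in>?A. \<forall>F\<in>C. ?R F U"
    proof (cases "C = {}")
      case True
      then show ?thesis using cof by blast
    next
      case False
      have "eventually P (Inf C) \<longleftrightarrow> (\<exists>F\<in>C. eventually P F)" for P
      proof (rule eventually_Inf_base[OF False])
        fix F G assume "F \<in> C" "G \<in> C"
        then show "\<exists>x\<in>C. x \<le> inf F G"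
          using lin[of F G] by auto
      qed
      then have "\<not> eventually (\<lambda>_. False) (Inf C)"
        using CA by (auto simp: trivial_limit_def)
      then have "Inf C \<noteq> bot"
        by (auto simp: trivial_limit_def)
      moreover have "Inf C \<le> cofinite"
      proof -
        obtain F where F: "F \<in> C"
          using False by blast
        then have "F \<le> cofinite"
          using CA by blast
        with F show ?thesis
          by (rule Inf_lower2)
      qed
      ultimately show ?thesis
        by (auto intro!: bexI[of _ "Inf C"] Inf_lower)
    qed
  qed
  then obtain U :: "nat filter" where U: "U \<noteq> bot" "U \<le> cofinite"
    and min: "\<And>F. F \<noteq> bot \<Longrightarrow> F \<le> cofinite \<Longrightarrow> F \<le> U \<Longrightarrow> F = U"
    by blast
  have "eventually P U \<or> eventually (\<lambda>n. \<not> P n) U" for P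
  proof (cases "inf U (principal {n. \<not> P n}) = bot")
    case True
    then have "eventually (\<lambda>_. False) (inf U (principal {n. \<not> P n}))"
      by simp
    then show ?thesis
      by (simp add: eventually_inf_principal)
  next
    case False
    have "inf U (principal {n. \<not> P n}) = U"
      by (rule min[OF False]) (use U in \<open>auto intro: le_infI1\<close>)
    then have "eventually (\<lambda>n. \<not> P n) (inf U (principal {n. \<not> P n})) \<longleftrightarrow> eventually (\<lambda>n. \<not> P n) U"
      by simp
    then show ?thesis
      by (simp add: eventually_inf_principal)
  qed
  with U show ?thesis
    unfolding free_ultrafilter_def by blast
qed

definition ufilter :: "nat filter" where
  "ufilter = (SOME U. free_ultrafilter U)"

lemma free_ultrafilter_ufilter: "free_ultrafilter ufilter"
  unfolding ufilter_def by (rule someI_ex[OF ex_free_ultrafilter])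

lemma ufilter_neq_bot: "ufilter \<noteq> bot"
  using free_ultrafilter_ufilter by (simp add: free_ultrafilter_def)

lemma ufilter_not: "eventually (\<lambda>n. \<not> P n) ufilter \<longleftrightarrow> \<not> eventually P ufilter"
proof
  assume "eventually (\<lambda>n. \<not> P n) ufilter"
  show "\<not> eventually P ufilter"
  proof
    assume "eventually P ufilter"
    with \<open>eventually (\<lambda>n. \<not> P n) ufilter\<close> have "eventually (\<lambda>_. False) ufilter"
      by eventually_elim simp
    then show False
      using ufilter_neq_bot by (simp add: trivial_limit_def)
  qed
next
  assume "\<not> eventually P ufilter"
  then show "eventually (\<lambda>n. \<not> P n) ufilter"
    using free_ultrafilter_ufilter by (auto simp: free_ultrafilter_def)
qed

lemma ufilter_disj:
  "eventually (\<lambda>n. P n \<or> Q n) ufilter \<longleftrightarrow> eventually P ufilter \<or> eventually Q ufilter"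
  using ufilter_not[of "\<lambda>n. P n \<or> Q n"] ufilter_not[of P] ufilter_not[of Q]
  by (auto simp: eventually_conj_iff)

section \<open>The hyperreal field\<close>

definition hyprel :: "(nat \<Rightarrow> real) \<Rightarrow> (nat \<Rightarrow> real) \<Rightarrow> bool" where
  "hyprel f g \<longleftrightarrow> eventually (\<lambda>n. f n = g n) ufilter"

quotient_type hyperreal = "nat \<Rightarrow> real" / hyprel
  morphisms rep_hyper abs_hyper
proof (rule equivpI)
  show "reflp hyprel" "symp hyprel"
    by (auto simp: reflp_def symp_def hyprel_def eq_commute)
  show "transp hyprel"
    unfolding transp_def hyprel_def by (auto elim: eventually_elim2)
qed

instantiation hyperreal :: field
begin

lift_definition zero_hyperreal :: hyperreal is "\<lambda>_. 0" .
lift_definition one_hyperreal :: hyperreal is "\<lambda>_. 1" .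
lift_definition plus_hyperreal :: "hyperreal \<Rightarrow> hyperreal \<Rightarrow> hyperreal" is "\<lambda>f g n. f n + g n"
  unfolding hyprel_def by (auto elim: eventually_elim2)
lift_definition minus_hyperreal :: "hyperreal \<Rightarrow> hyperreal \<Rightarrow> hyperreal" is "\<lambda>f g n. f n - g n"
  unfolding hyprel_def by (auto elim: eventually_elim2)
lift_definition uminus_hyperreal :: "hyperreal \<Rightarrow> hyperreal" is "\<lambda>f n. - f n"
  unfolding hyprel_def by (auto elim: eventually_mono)
lift_definition times_hyperreal :: "hyperreal \<Rightarrow> hyperreal \<Rightarrow> hyperreal" is "\<lambda>f g n. f n * g n"
  unfolding hyprel_def by (auto elim: eventually_elim2)
lift_definition inverse_hyperreal :: "hyperreal \<Rightarrow> hyperreal" is "\<lambda>f n. inverse (f n)"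
  unfolding hyprel_def by (auto elim: eventually_mono)
lift_definition divide_hyperreal :: "hyperreal \<Rightarrow> hyperreal \<Rightarrow> hyperreal" is "\<lambda>f g n. f n / g n"
  unfolding hyprel_def by (auto elim: eventually_elim2)

instance
proof
  fix a b c :: hyperreal
  show "a + b + c = a + (b + c)" "a + b = b + a" "0 + a = a" "- a + a = 0" "a - b = a + - b"
    "a * b * c = a * (b * c)" "a * b = b * a" "1 * a = a" "(a + b) * c = a * c + b * c"
    "a div b = a * inverse b" "inverse (0::hyperreal) = 0"
    by (transfer, simp add: hyprel_def algebra_simps divide_inverse)+
  show "(0::hyperreal) \<noteq> 1"
    by transfer (simp add: hyprel_def ufilter_neq_bot)
  show "inverse a * a = 1" if "a \<noteq> 0"
    using that
  proof transfer
    fix f assume "\<not> hyprel f (\<lambda>_. 0)"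
    then have "eventually (\<lambda>n. f n \<noteq> 0) ufilter"
      by (simp add: hyprel_def ufilter_not)
    then show "hyprel (\<lambda>n. inverse (f n) * f n) (\<lambda>_. 1)"
      unfolding hyprel_def by eventually_elim simp
  qed
qed

end

instantiation hyperreal :: linordered_field
begin

lift_definition abs_hyperreal :: "hyperreal \<Rightarrow> hyperreal" is "\<lambda>f n. \<bar>f n\<bar>"
  unfolding hyprel_def by (auto elim: eventually_mono)
lift_definition sgn_hyperreal :: "hyperreal \<Rightarrow> hyperreal" is "\<lambda>f n. sgn (f n)"
  unfolding hyprel_def by (auto elim: eventually_mono)
lift_definition less_eq_hyperreal :: "hyperreal \<Rightarrow> hyperreal \<Rightarrow> bool"
  is "\<lambda>f g. eventually (\<lambda>n. f n \<le> g n) ufilter"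
proof -
  fix f f' g g' assume "hyprel f f'" "hyprel g g'"
  then have "eventually (\<lambda>n. f n = f' n \<and> g n = g' n) ufilter"
    unfolding hyprel_def by (simp add: eventually_conj_iff)
  then have "eventually (\<lambda>n. (f n \<le> g n) = (f' n \<le> g' n)) ufilter"
    by eventually_elim simp
  then show "eventually (\<lambda>n. f n \<le> g n) ufilter = eventually (\<lambda>n. f' n \<le> g' n) ufilter"
    by (rule eventually_subst)
qed
lift_definition less_hyperreal :: "hyperreal \<Rightarrow> hyperreal \<Rightarrow> bool"
  is "\<lambda>f g. eventually (\<lambda>n. f n < g n) ufilter"
proof -
  fix f f' g g' assume "hyprel f f'" "hyprel g g'"
  then have "eventually (\<lambda>n. f n = f' n \<and> g n = g' n) ufilter"
    unfolding hyprel_def by (simp add: eventually_conj_iff)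
  then have "eventually (\<lambda>n. (f n < g n) = (f' n < g' n)) ufilter"
    by eventually_elim simp
  then show "eventually (\<lambda>n. f n < g n) ufilter = eventually (\<lambda>n. f' n < g' n) ufilter"
    by (rule eventually_subst)
qed

instance
proof
  fix a b c :: hyperreal
  show "(a < b) = (a \<le> b \<and> \<not> b \<le> a)"
  proof transfer
    fix f g :: "nat \<Rightarrow> real"
    have "eventually (\<lambda>n. f n < g n) ufilter \<longleftrightarrow>
        eventually (\<lambda>n. f n \<le> g n \<and> \<not> g n \<le> f n) ufilter"
      by (simp only: less_le_not_le)
    then show "eventually (\<lambda>n. f n < g n) ufilter \<longleftrightarrow>
        eventually (\<lambda>n. f n \<le> g n) ufilter \<and> \<not> eventually (\<lambda>n. g n \<le> f n) ufilter"
      by (simp only: eventually_conj_iff ufilter_not)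
  qed
  show "a \<le> a"
    by transfer simp
  show "a \<le> c" if "a \<le> b" "b \<le> c"
    using that by transfer (auto elim: eventually_elim2)
  show "a = b" if "a \<le> b" "b \<le> a"
    using that by transfer (auto simp: hyprel_def elim: eventually_elim2)
  show "a \<le> b \<or> b \<le> a"
    by transfer (simp only: linear eventually_True flip: ufilter_disj)
  show "c + a \<le> c + b" if "a \<le> b"
    using that by transfer simp
  show "c * a < c * b" if "a < b" "0 < c"
    using that by transfer (auto elim: eventually_elim2)
  show "\<bar>a\<bar> = (if a < 0 then - a else a)"
  proof (cases "a < 0")
    case True
    then have "\<bar>a\<bar> = - a"
      by transfer (auto simp: hyprel_def elim: eventually_mono)
    with True show ?thesis by simp
  next
    case False
    then have "\<bar>a\<bar> = a"
    proof transfer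
      fix f :: "nat \<Rightarrow> real" assume "\<not> eventually (\<lambda>n. f n < 0) ufilter"
      then have "eventually (\<lambda>n. \<not> f n < 0) ufilter"
        by (simp only: ufilter_not not_False_eq_True)
      then show "hyprel (\<lambda>n. \<bar>f n\<bar>) f"
        unfolding hyprel_def by eventually_elim simp
    qed
    with False show ?thesis by simp
  qed
  show "sgn a = (if a = 0 then 0 else if 0 < a then 1 else - 1)"
  proof -
    have "sgn a = 0" if "a = 0"
      using that by transfer (auto simp: hyprel_def elim: eventually_mono)
    moreover have "sgn a = 1" if "0 < a"
      using that by transfer (auto simp: hyprel_def elim: eventually_mono)
    moreover have "sgn a = - 1" if "a \<noteq> 0" "\<not> 0 < a"
      using that
    proof transfer
      fix f :: "nat \<Rightarrow> real"
      assume "\<not> hyprel f (\<lambda>_. 0)" "\<not> eventually (\<lambda>n. 0 < f n) ufilter"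
      then have "eventually (\<lambda>n. f n \<noteq> 0) ufilter" "eventually (\<lambda>n. \<not> 0 < f n) ufilter"
        by (simp_all only: hyprel_def ufilter_not not_False_eq_True)
      then show "hyprel (\<lambda>n. sgn (f n)) (\<lambda>_. - 1)"
        unfolding hyprel_def by eventually_elim simp
    qed
    ultimately show ?thesis by auto
  qed
qed

end

text \<open>The natural extension of the real square root.\<close>

lift_definition hsqrt :: "hyperreal \<Rightarrow> hyperreal" is "\<lambda>f n. sqrt (f n)"
  unfolding hyprel_def by (auto elim: eventually_mono)

lemma hsqrt_nonneg: "0 \<le> a \<Longrightarrow> 0 \<le> hsqrt a"
  by transfer (auto elim: eventually_mono)

lemma hsqrt_square: "0 \<le> a \<Longrightarrow> hsqrt a * hsqrt a = a"
  by transfer (auto simp: hyprel_def elim: eventually_mono)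

lemma hsqrt_mult: "hsqrt (a * b) = hsqrt a * hsqrt b"
  by transfer (simp add: hyprel_def real_sqrt_mult)

lemma hsqrt_power2: "hsqrt (a * a) = \<bar>a\<bar>"
  by transfer (simp add: hyprel_def)

section \<open>Orders of magnitude\<close>

text \<open>Zero counts as infinitesimal, but not as appreciable.\<close>

definition infinitesimal :: "hyperreal \<Rightarrow> bool" where
  "infinitesimal r \<longleftrightarrow> (\<forall>n::nat. n \<ge> 1 \<longrightarrow> \<bar>r\<bar> < 1 / of_nat n)"

definition appreciable :: "hyperreal \<Rightarrow> bool" where
  "appreciable r \<longleftrightarrow> (\<exists>n::nat. n \<ge> 1 \<and> 1 / of_nat n < \<bar>r\<bar> \<and> \<bar>r\<bar> < of_nat n)"

definition mag :: "hyperreal \<Rightarrow> hyperreal set" where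
  "mag r = {s. s \<noteq> 0 \<and> (\<exists>A. appreciable A \<and> r = A * s)}"

section \<open>Vectors and matrices over the hyperreals\<close>

text \<open>The class \<open>norm\<close> of the library has real-valued norms; here norms are hyperreal.\<close>

definition hnorm :: "hyperreal^'n \<Rightarrow> hyperreal" where
  "hnorm x = hsqrt (\<Sum>i\<in>UNIV. (x $ i)\<^sup>2)"

definition frobenius_norm :: "hyperreal^'n^'m \<Rightarrow> hyperreal" where
  "frobenius_norm M = hsqrt (\<Sum>i\<in>UNIV. \<Sum>j\<in>UNIV. (M $ i $ j)\<^sup>2)"

text \<open>The library's cross product is confined to real vectors.\<close>

definition hcross :: "hyperreal^3 \<Rightarrow> hyperreal^3 \<Rightarrow> hyperreal^3" where
  "hcross a b = vector [a$2 * b$3 - a$3 * b$2,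
                        a$3 * b$1 - a$1 * b$3,
                        a$1 * b$2 - a$2 * b$1]"

section \<open>The hyperreal projective plane\<close>

definition projrel :: "hyperreal^3 \<Rightarrow> hyperreal^3 \<Rightarrow> bool" where
  "projrel x y \<longleftrightarrow> x \<noteq> 0 \<and> y \<noteq> 0 \<and> (\<exists>c. c \<noteq> 0 \<and> y = c *s x)"

text \<open>Points and lines are both elements of this type.\<close>

quotient_type hproj = "hyperreal^3" / partial: projrel
proof (rule part_equivpI)
  show "\<exists>x. projrel x x"
    unfolding projrel_def by (intro exI[of _ 1] exI[of _ "1::hyperreal"] conjI) auto
  show "symp projrel"
  proof (rule sympI)
    fix x y :: "hyperreal^3"
    assume "projrel x y"
    then obtain c where c: "x \<noteq> 0" "y \<noteq> 0" "c \<noteq> 0" "y = c *s x"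
      unfolding projrel_def by blast
    then have "x = inverse c *s y"
      by (simp add: vector_smult_assoc)
    with c show "projrel y x"
      unfolding projrel_def using nonzero_imp_inverse_nonzero by blast
  qed
  show "transp projrel"
    unfolding transp_def projrel_def by (metis vector_smult_assoc mult_eq_0_iff)
qed

text \<open>\<open>represents x P\<close>: the vector \<open>x\<close> is a homogeneous coordinate vector of \<open>P\<close>.\<close>

definition represents :: "hyperreal^3 \<Rightarrow> hproj \<Rightarrow> bool" where
  "represents x P \<longleftrightarrow> x \<noteq> 0 \<and> abs_hproj x = P"

text \<open>All appreciable representatives of a point or line (and, below, of a matrix).\<close>

definition areps :: "hproj \<Rightarrow> (hyperreal^3) set" where
  "areps P = {inverse l *s x | l x. represents x P \<and> l \<in> mag (hnorm x)}"

definition mat_areps :: "hyperreal^3^3 \<Rightarrow> (hyperreal^3^3) set" where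
  "mat_areps M = {(\<chi> i j. inverse l * M $ i $ j) | l. l \<in> mag (frobenius_norm M)}"

text \<open>Appreciable representatives are determined only up to appreciable factors;
  a fixed choice is made. The lemmas \<open>join_eq\<close>, \<open>almost_incident_iff\<close> and
  \<open>nonsingular_iff\<close> below show that nothing depends on it.\<close>

definition arep :: "hproj \<Rightarrow> hyperreal^3" where
  "arep P = (SOME v. v \<in> areps P)"

definition mat_arep :: "hyperreal^3^3 \<Rightarrow> hyperreal^3^3" where
  "mat_arep M = (SOME N. N \<in> mat_areps M)"

definition nonsingular :: "hyperreal^3^3 \<Rightarrow> bool" where
  "nonsingular M \<longleftrightarrow> M \<noteq> 0 \<and> appreciable (det (mat_arep M))"

text \<open>Meaningful only for \<open>P \<noteq> Q\<close>: otherwise the cross product is the zero vector, which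
  represents no line.\<close>

definition join :: "hproj \<Rightarrow> hproj \<Rightarrow> hproj" where
  "join P Q = abs_hproj (hcross (arep P) (arep Q))"

definition almost_incident :: "hproj \<Rightarrow> hproj \<Rightarrow> bool" where
  "almost_incident P l \<longleftrightarrow> infinitesimal (scalar_product (arep P) (arep l))"

text \<open>Not symmetric in its three arguments: two of the points may be infinitesimally close.\<close>

definition almost_collinear :: "hproj \<Rightarrow> hproj \<Rightarrow> hproj \<Rightarrow> bool" where
  "almost_collinear P Q R \<longleftrightarrow> almost_incident P (join Q R)"

text \<open>Meaningful only for invertible \<open>M\<close>; see \<open>represents_transform\<close> below.\<close>

definition transform :: "hyperreal^3^3 \<Rightarrow> hproj \<Rightarrow> hproj" where
  "transform M P = abs_hproj (M *v rep_hproj P)"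

section \<open>Independence of representatives\<close>

lemma projrel_refl_iff: "projrel x x \<longleftrightarrow> x \<noteq> 0"
  unfolding projrel_def by (metis vector_smult_lid zero_neq_one)

lemma represents_rep: "represents (rep_hproj P) P"
  using Quotient3_rep_reflp[OF Quotient3_hproj] Quotient3_abs_rep[OF Quotient3_hproj]
  by (simp add: represents_def projrel_refl_iff)

lemma abs_hproj_eq_iff:
  assumes "x \<noteq> 0" "y \<noteq> 0"
  shows "abs_hproj x = abs_hproj y \<longleftrightarrow> (\<exists>c. c \<noteq> 0 \<and> y = c *s x)"
  using Quotient3_rel[OF Quotient3_hproj, of x y] assms
  by (auto simp: projrel_refl_iff) (auto simp: projrel_def)

lemma representsD:
  assumes "represents x P" "represents y P"
  obtains c where "c \<noteq> 0" "y = c *s x"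
  using assms abs_hproj_eq_iff[of x y] unfolding represents_def by auto

lemma represents_transform:
  assumes "invertible M" "represents x P"
  shows "represents (M *v x) (transform M P)"
proof -
  have nz: "M *v y \<noteq> 0" if "y \<noteq> 0" for y
    using assms(1) that by (metis invertible_def matrix_vector_mul_assoc matrix_vector_mul_lid
        matrix_vector_mult_0_right)
  obtain c where c: "c \<noteq> 0" "rep_hproj P = c *s x"
    using representsD[OF assms(2) represents_rep] .
  have "M *v rep_hproj P = c *s (M *v x)"
    by (simp add: c vector_scalar_commute)
  moreover have "x \<noteq> 0" "rep_hproj P \<noteq> 0"
    using assms(2) represents_rep by (auto simp: represents_def)
  ultimately show ?thesis
    unfolding represents_def transform_def using nz c(1) abs_hproj_eq_iff by metis
qed

lemma appreciable_iff:
  "appreciable r \<longleftrightarrow> (\<exists>m n::nat. m \<ge> 1 \<and> n \<ge> 1 \<and> 1 / of_nat m \<le> \<bar>r\<bar> \<and> \<bar>r\<bar> \<le> of_nat n)"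
proof
  assume "appreciable r"
  then show "\<exists>m n::nat. m \<ge> 1 \<and> n \<ge> 1 \<and> 1 / of_nat m \<le> \<bar>r\<bar> \<and> \<bar>r\<bar> \<le> of_nat n"
    unfolding appreciable_def by (auto intro: less_imp_le)
next
  assume "\<exists>m n::nat. m \<ge> 1 \<and> n \<ge> 1 \<and> 1 / of_nat m \<le> \<bar>r\<bar> \<and> \<bar>r\<bar> \<le> of_nat n"
  then obtain m n :: nat where mn: "m \<ge> 1" "n \<ge> 1" "1 / of_nat m \<le> \<bar>r\<bar>" "\<bar>r\<bar> \<le> of_nat n"
    by blast
  have "1 / of_nat (m + n) < (1 / of_nat m :: hyperreal)"
    using mn(1,2) by (simp add: frac_less2)
  moreover have "(of_nat n :: hyperreal) < of_nat (m + n)"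
    using mn(1) by (subst of_nat_less_iff) simp
  ultimately show "appreciable r"
    unfolding appreciable_def using mn
    by (intro exI[of _ "m + n"]) (metis le_less_trans less_le_trans trans_le_add1)
qed

lemma appreciable_1: "appreciable 1"
  unfolding appreciable_iff by (intro exI[of _ 1]) simp

lemma appreciable_nonzero: "appreciable r \<Longrightarrow> r \<noteq> 0"
  by (auto simp: appreciable_def)

lemma appreciable_abs: "appreciable \<bar>r\<bar> \<longleftrightarrow> appreciable r"
  by (simp add: appreciable_def)

lemma appreciable_mult:
  assumes "appreciable r" "appreciable s"
  shows "appreciable (r * s)"
proof -
  obtain m n where mn: "m \<ge> 1" "1 / of_nat m \<le> \<bar>r\<bar>" "\<bar>r\<bar> \<le> of_nat m"
    "n \<ge> 1" "1 / of_nat n \<le> \<bar>s\<bar>" "\<bar>s\<bar> \<le> of_nat n"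
    using assms unfolding appreciable_def by (metis less_imp_le)
  have "1 / of_nat (m * n) \<le> \<bar>r * s\<bar>"
    using mult_mono[OF mn(2,5)] by (simp add: abs_mult)
  moreover have "\<bar>r * s\<bar> \<le> of_nat (m * n)"
    using mult_mono[OF mn(3,6)] by (simp add: abs_mult)
  moreover have "m * n \<ge> 1"
    using mn by simp
  ultimately show ?thesis
    unfolding appreciable_iff by blast
qed

lemma appreciable_inverse:
  assumes "appreciable r"
  shows "appreciable (inverse r)"
proof -
  obtain n :: nat where n: "n \<ge> 1" "1 / of_nat n < \<bar>r\<bar>" "\<bar>r\<bar> < of_nat n"
    using assms unfolding appreciable_def by blast
  have r: "0 < \<bar>r\<bar>"
    using appreciable_nonzero[OF assms] by simp
  have "1 / of_nat n \<le> inverse \<bar>r\<bar>"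
    using n r by (simp add: field_simps less_imp_le)
  moreover have "inverse \<bar>r\<bar> \<le> of_nat n"
    using n r by (simp add: field_simps less_imp_le)
  ultimately show ?thesis
    unfolding appreciable_iff using n(1) by (auto simp: abs_inverse)
qed

lemma appreciable_mult_iff: "appreciable c \<Longrightarrow> appreciable (c * r) \<longleftrightarrow> appreciable r"
  using appreciable_mult[of c r] appreciable_mult[of "inverse c" "c * r"] appreciable_inverse[of c]
    appreciable_nonzero[of c]
  by (auto simp: mult.assoc[symmetric])

lemma infinitesimal_mult:
  assumes "appreciable c" "infinitesimal r"
  shows "infinitesimal (c * r)"
  unfolding infinitesimal_def
proof (intro allI impI)
  fix k :: nat assume k: "k \<ge> 1"
  obtain n :: nat where n: "n \<ge> 1" "\<bar>c\<bar> < of_nat n"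
    using assms(1) unfolding appreciable_def by blast
  have "n * k \<ge> 1"
    using n(1) k by simp
  then have "\<bar>r\<bar> < 1 / of_nat (n * k)"
    using assms(2) unfolding infinitesimal_def by blast
  then have "\<bar>c\<bar> * \<bar>r\<bar> < of_nat n * (1 / of_nat (n * k))"
    using n by (intro mult_strict_mono) auto
  then show "\<bar>c * r\<bar> < 1 / of_nat k"
    using n(1) by (simp add: abs_mult)
qed

lemma infinitesimal_mult_iff: "appreciable c \<Longrightarrow> infinitesimal (c * r) \<longleftrightarrow> infinitesimal r"
  using infinitesimal_mult[of c r] infinitesimal_mult[of "inverse c" "c * r"]
    appreciable_inverse[of c] appreciable_nonzero[of c]
  by (auto simp: mult.assoc[symmetric])

lemma self_in_mag: "r \<noteq> 0 \<Longrightarrow> r \<in> mag r"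
  unfolding mag_def using appreciable_1 by (auto intro!: exI[of _ 1])

lemma hnorm_scale: "hnorm (c *s x) = \<bar>c\<bar> * hnorm x"
proof -
  have "(\<Sum>i\<in>UNIV. ((c *s x) $ i)\<^sup>2) = (c * c) * (\<Sum>i\<in>UNIV. (x $ i)\<^sup>2)"
    by (simp add: sum_distrib_left power2_eq_square algebra_simps)
  then show ?thesis
    unfolding hnorm_def by (simp only: hsqrt_mult[of "c * c"] hsqrt_power2)
qed

lemma hsqrt_eq_0: "0 \<le> a \<Longrightarrow> hsqrt a = 0 \<Longrightarrow> a = 0"
  using hsqrt_square[of a] by simp

lemma hnorm_nonzero: "x \<noteq> 0 \<Longrightarrow> hnorm x \<noteq> 0"
proof
  assume "x \<noteq> 0" "hnorm x = 0"
  then have "(\<Sum>i\<in>UNIV. (x $ i)\<^sup>2) = 0"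
    using hsqrt_eq_0[of "\<Sum>i\<in>UNIV. (x $ i)\<^sup>2"] by (simp add: hnorm_def sum_nonneg)
  then have "\<forall>i. x $ i = 0"
    by (subst (asm) sum_nonneg_eq_0_iff) auto
  then show False
    using \<open>x \<noteq> 0\<close> by (simp add: vec_eq_iff)
qed

lemma frobenius_norm_nonzero: "M \<noteq> 0 \<Longrightarrow> frobenius_norm M \<noteq> 0"
proof
  assume "M \<noteq> 0" "frobenius_norm M = 0"
  then have "(\<Sum>i\<in>UNIV. \<Sum>j\<in>UNIV. (M $ i $ j)\<^sup>2) = 0"
    using hsqrt_eq_0[of "\<Sum>i\<in>UNIV. \<Sum>j\<in>UNIV. (M $ i $ j)\<^sup>2"]
    by (simp add: frobenius_norm_def sum_nonneg)
  then have "\<forall>i. (\<Sum>j\<in>UNIV. (M $ i $ j)\<^sup>2) = 0"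
    by (subst (asm) sum_nonneg_eq_0_iff) (auto intro: sum_nonneg)
  then have "\<forall>i j. M $ i $ j = 0"
    by (subst (asm) sum_nonneg_eq_0_iff) auto
  then show False
    using \<open>M \<noteq> 0\<close> by (simp add: vec_eq_iff)
qed

lemma arep_in_areps: "arep P \<in> areps P"
proof -
  have "inverse (hnorm (rep_hproj P)) *s rep_hproj P \<in> areps P"
  proof -
    have "rep_hproj P \<noteq> 0"
      using represents_rep by (auto simp: represents_def)
    then show ?thesis
      unfolding areps_def using represents_rep self_in_mag[OF hnorm_nonzero] by blast
  qed
  then show ?thesis
    unfolding arep_def by (rule someI)
qed

lemma mat_arep_in_mat_areps: "M \<noteq> 0 \<Longrightarrow> mat_arep M \<in> mat_areps M"
proof -
  assume "M \<noteq> 0"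
  then have "(\<chi> i j. inverse (frobenius_norm M) * M $ i $ j) \<in> mat_areps M"
    unfolding mat_areps_def using self_in_mag frobenius_norm_nonzero by blast
  then show ?thesis
    unfolding mat_arep_def by (rule someI)
qed

lemma areps_represents: "v \<in> areps P \<Longrightarrow> represents v P"
proof -
  assume "v \<in> areps P"
  then obtain l x where x: "v = inverse l *s x" "represents x P" "l \<noteq> 0"
    unfolding areps_def mag_def by blast
  then have "x \<noteq> 0" "v \<noteq> 0"
    by (auto simp: represents_def)
  then have "abs_hproj x = abs_hproj v"
    using abs_hproj_eq_iff x nonzero_imp_inverse_nonzero by blast
  then show ?thesis
    using x(2) \<open>v \<noteq> 0\<close> by (simp add: represents_def)
qed

lemma hnorm_areps: "v \<in> areps P \<Longrightarrow> appreciable (hnorm v)"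
proof -
  assume "v \<in> areps P"
  then obtain l x A where x: "v = inverse l *s x" "l \<noteq> 0" "appreciable A" "hnorm x = A * l"
    unfolding areps_def mag_def by blast
  have "\<bar>hnorm v\<bar> = \<bar>A\<bar>"
    using x(2,4) by (simp add: x(1) hnorm_scale abs_mult abs_inverse)
  then show ?thesis
    using x(3) appreciable_abs by metis
qed

lemma areps_unique:
  assumes "u \<in> areps P" "v \<in> areps P"
  obtains c where "appreciable c" "v = c *s u"
proof -
  obtain c where c: "v = c *s u"
    using representsD[OF areps_represents[OF assms(1)] areps_represents[OF assms(2)]] by blast
  have "appreciable (hnorm u * \<bar>c\<bar>)"
    using hnorm_areps[OF assms(2)] by (simp add: c hnorm_scale mult.commute)
  then have "appreciable c"
    using hnorm_areps[OF assms(1)] appreciable_mult_iff appreciable_abs by blast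
  with c that show ?thesis by blast
qed

lemma hcross_scale: "hcross (c *s x) (d *s y) = (c * d) *s hcross x y"
  by (simp add: hcross_def vec_eq_iff forall_3 algebra_simps)

lemma scalar_product_scale: "scalar_product (c *s x) (d *s y) = (c * d) * scalar_product x y"
  for c d :: hyperreal
  by (simp add: scalar_product_def sum_distrib_left mult.assoc mult.left_commute)

lemma hcross_nonzero:
  assumes "represents x P" "represents y Q" "P \<noteq> Q"
  shows "hcross x y \<noteq> 0"
proof
  assume "hcross x y = 0"
  then have e: "x$2 * y$3 = x$3 * y$2" "x$3 * y$1 = x$1 * y$3" "x$1 * y$2 = x$2 * y$1"
    by (auto simp: hcross_def vec_eq_iff forall_3)
  have nz: "x \<noteq> 0" "y \<noteq> 0"
    using assms by (auto simp: represents_def)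
  have e': "x $ i * y $ j = x $ j * y $ i" for i j :: 3
    using exhaust_3[of i] exhaust_3[of j] e by auto
  obtain i where i: "x $ i \<noteq> 0"
    using nz(1) by (auto simp: vec_eq_iff)
  have y: "y = (y $ i / x $ i) *s x"
    using i e' by (simp add: vec_eq_iff field_simps)
  then have "y $ i / x $ i \<noteq> 0"
    using nz(2) by auto
  then have "abs_hproj x = abs_hproj y"
    using y nz abs_hproj_eq_iff by blast
  then show False
    using assms by (simp add: represents_def)
qed

lemma join_eq:
  assumes "P \<noteq> Q" "u \<in> areps P" "v \<in> areps Q"
  shows "represents (hcross u v) (join P Q)"
proof -
  obtain c where c: "appreciable c" "arep P = c *s u"
    using areps_unique[OF assms(2) arep_in_areps] .
  obtain d where d: "appreciable d" "arep Q = d *s v"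
    using areps_unique[OF assms(3) arep_in_areps] .
  have nz: "hcross u v \<noteq> 0"
    using hcross_nonzero[OF areps_represents[OF assms(2)] areps_represents[OF assms(3)] assms(1)] .
  have cd: "c * d \<noteq> 0"
    using c d appreciable_nonzero by simp
  have "hcross (arep P) (arep Q) = (c * d) *s hcross u v"
    by (simp add: c d hcross_scale)
  then have "abs_hproj (hcross u v) = join P Q"
    unfolding join_def using nz cd abs_hproj_eq_iff[of "hcross u v" "hcross (arep P) (arep Q)"] 
    by (metis vector_mul_eq_0)
  with nz show ?thesis
    by (simp add: represents_def)
qed

lemma almost_incident_iff:
  assumes "u \<in> areps P" "v \<in> areps l"
  shows "almost_incident P l \<longleftrightarrow> infinitesimal (scalar_product u v)"
proof -
  obtain c where c: "appreciable c" "arep P = c *s u"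
    using areps_unique[OF assms(1) arep_in_areps] .
  obtain d where d: "appreciable d" "arep l = d *s v"
    using areps_unique[OF assms(2) arep_in_areps] .
  show ?thesis
    unfolding almost_incident_def c(2) d(2) scalar_product_scale
    by (rule infinitesimal_mult_iff[OF appreciable_mult[OF c(1) d(1)]])
qed

lemma nonsingular_iff:
  assumes "N \<in> mat_areps M" "M \<noteq> 0"
  shows "nonsingular M \<longleftrightarrow> appreciable (det N)"
proof -
  obtain l A where l: "N = (\<chi> i j. inverse l * M $ i $ j)" "l \<noteq> 0" "appreciable A"
      "frobenius_norm M = A * l"
    using assms(1) unfolding mat_areps_def mag_def by blast
  obtain k B where k: "mat_arep M = (\<chi> i j. inverse k * M $ i $ j)" "k \<noteq> 0" "appreciable B"
      "frobenius_norm M = B * k"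
    using mat_arep_in_mat_areps[OF assms(2)] unfolding mat_areps_def mag_def by blast
  define c where "c = B * inverse A"
  have c: "appreciable c"
    unfolding c_def by (intro appreciable_mult appreciable_inverse l k)
  have "A \<noteq> 0" "B \<noteq> 0"
    using l(3) k(3) appreciable_nonzero by auto
  then have "inverse k = c * inverse l"
    using l(2,4) k(2,4) by (simp add: c_def field_simps)
  then have "det (mat_arep M) = (c * c * c) * det N"
    by (simp add: l(1) k(1) det_3 algebra_simps)
  then show ?thesis
    unfolding nonsingular_def
    using assms(2) appreciable_mult_iff[OF appreciable_mult[OF appreciable_mult[OF c c] c]]
    by simp
qed

end

theory Submission
  imports Defs
begin

text \<open>
  For homogeneous coordinate vectors \<open>x\<close> of a point and \<open>y\<close> of a line, almost incidence says that
  the cosine \<open>\<langle>x, y\<rangle> / (\<parallel>x\<parallel> \<parallel>y\<parallel>)\<close> is infinitesimal. This quotient does not change when \<open>x\<close> and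
  \<open>y\<close> are rescaled, so it may be computed with any representatives
  (\<open>almost_incident_iff_cosine_infinitesimal\<close>).

  Let \<open>C\<close> be the cofactor matrix of \<open>M\<close>. If \<open>M\<close> moves points, then \<open>C\<close> moves lines, because
  \<open>Mv \<times> Mw = C (v \<times> w)\<close>. Since \<open>M\<^sup>T C = det M\<close>, the numerator of the cosine is multiplied by
  \<open>det M\<close>. The denominator cannot shrink too much: \<open>C\<^sup>T M = det M\<close> and \<open>M\<^sup>T C = det M\<close> give
  \<open>\<bar>det M\<bar> \<parallel>x\<parallel> \<le> \<parallel>C\<parallel> \<parallel>M x\<parallel>\<close> and \<open>\<bar>det M\<bar> \<parallel>y\<parallel> \<le> \<parallel>M\<parallel> \<parallel>C y\<parallel>\<close>, and \<open>\<parallel>C\<parallel> \<le> \<parallel>M\<parallel>\<^sup>2\<close>. So the cosine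
  grows at most by the factor \<open>\<parallel>M\<parallel>\<^sup>3 / \<bar>det M\<bar>\<close> (\<open>cosine_transform_le\<close>). This factor is also invariant
  under rescaling, and \<open>M\<close> is non-singular precisely when it is appreciable. An appreciable multiple
  of an infinitesimal is infinitesimal, which proves the claim.
\<close>

section \<open>Cauchy--Schwarz estimates for hyperreal norms\<close>

lemma hsqrt_mono: "a \<le> b \<Longrightarrow> hsqrt a \<le> hsqrt b"
  by transfer (auto elim: eventually_mono)

lemma hnorm_nonneg: "0 \<le> hnorm x"
  unfolding hnorm_def by (intro hsqrt_nonneg sum_nonneg) simp

lemma hnorm_pos: "x \<noteq> 0 \<Longrightarrow> 0 < hnorm x"
  using hnorm_nonneg[of x] hnorm_nonzero[of x] by linarith

lemma hnorm_power2: "(hnorm x)\<^sup>2 = (\<Sum>i\<in>UNIV. (x $ i)\<^sup>2)"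
  unfolding hnorm_def power2_eq_square[of "hsqrt _"] by (intro hsqrt_square sum_nonneg) simp

lemma frobenius_norm_nonneg: "0 \<le> frobenius_norm M"
  unfolding frobenius_norm_def by (intro hsqrt_nonneg sum_nonneg) simp

lemma frobenius_norm_power2: "(frobenius_norm M)\<^sup>2 = (\<Sum>i\<in>UNIV. \<Sum>j\<in>UNIV. (M $ i $ j)\<^sup>2)"
  unfolding frobenius_norm_def power2_eq_square[of "hsqrt _"]
  by (intro hsqrt_square sum_nonneg) simp

lemma frobenius_norm_transpose: "frobenius_norm (transpose M) = frobenius_norm M"
  unfolding frobenius_norm_def by (subst sum.swap) (simp add: transpose_def)

lemma hnorm_matrix_vector_le: "hnorm (M *v x) \<le> frobenius_norm M * hnorm x"
proof -
  have "(\<Sum>i\<in>UNIV. ((M *v x) $ i)\<^sup>2) \<le>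
      (\<Sum>i\<in>UNIV. (\<Sum>j\<in>UNIV. (M $ i $ j)\<^sup>2) * (\<Sum>j\<in>UNIV. (x $ j)\<^sup>2))"
    by (intro sum_mono) (simp add: matrix_vector_mult_def Cauchy_Schwarz_ineq_sum)
  then show ?thesis
    unfolding hnorm_def frobenius_norm_def hsqrt_mult[symmetric] sum_distrib_right[symmetric]
    by (rule hsqrt_mono)
qed

section \<open>The action of a matrix on lines\<close>

definition cofactor3 :: "hyperreal^3^3 \<Rightarrow> hyperreal^3^3" where
  "cofactor3 M = vector [hcross (M$2) (M$3), hcross (M$3) (M$1), hcross (M$1) (M$2)]"

lemma hcross_matrix_vector: "hcross (M *v v) (M *v w) = cofactor3 M *v hcross v w"
  by (simp add: cofactor3_def hcross_def matrix_vector_mult_def vec_eq_iff forall_3 sum_3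
      algebra_simps)

lemma transpose_cofactor3_mult: "transpose M *v (cofactor3 M *v y) = det M *s y"
  by (simp add: cofactor3_def hcross_def matrix_vector_mult_def transpose_def vec_eq_iff forall_3
      sum_3 det_3 algebra_simps)

lemma cofactor3_transpose_mult: "transpose (cofactor3 M) *v (M *v x) = det M *s x"
  by (simp add: cofactor3_def hcross_def matrix_vector_mult_def transpose_def vec_eq_iff forall_3
      sum_3 det_3 algebra_simps)

lemma scalar_product_cofactor3:
  "scalar_product (M *v x) (cofactor3 M *v y) = det M * scalar_product x y"
  by (simp add: cofactor3_def hcross_def matrix_vector_mult_def scalar_product_def sum_3 det_3
      algebra_simps)

text \<open>By Lagrange's identity, \<open>\<parallel>a \<times> b\<parallel>\<^sup>2 = \<parallel>a\<parallel>\<^sup>2 \<parallel>b\<parallel>\<^sup>2 - \<langle>a, b\<rangle>\<^sup>2\<close>.\<close>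

lemma hnorm_hcross_le: "hnorm (hcross a b) \<le> hnorm a * hnorm b"
proof -
  have "(\<Sum>i\<in>UNIV. (hcross a b $ i)\<^sup>2) + (scalar_product a b)\<^sup>2
      = (\<Sum>i\<in>UNIV. (a $ i)\<^sup>2) * (\<Sum>i\<in>UNIV. (b $ i)\<^sup>2)"
    by (simp add: hcross_def scalar_product_def sum_3 power2_eq_square algebra_simps)
  then have "(\<Sum>i\<in>UNIV. (hcross a b $ i)\<^sup>2) \<le> (\<Sum>i\<in>UNIV. (a $ i)\<^sup>2) * (\<Sum>i\<in>UNIV. (b $ i)\<^sup>2)"
    by (metis le_add_same_cancel1 zero_le_power2)
  then show ?thesis
    unfolding hnorm_def hsqrt_mult[symmetric] by (rule hsqrt_mono)
qed

lemma frobenius_norm_cofactor3_le: "frobenius_norm (cofactor3 M) \<le> (frobenius_norm M)\<^sup>2"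
proof (rule power2_le_imp_le)
  have rows: "(hnorm (hcross (M $ i) (M $ j)))\<^sup>2 \<le> (hnorm (M $ i))\<^sup>2 * (hnorm (M $ j))\<^sup>2" for i j
    unfolding power_mult_distrib[symmetric] by (rule power_mono[OF hnorm_hcross_le hnorm_nonneg])
  have sum_of_products: "a * b + (b * c + c * a) \<le> (a + b + c)\<^sup>2" if "0 \<le> a" "0 \<le> b" "0 \<le> c"
    for a b c :: hyperreal
    using that by (simp add: power2_eq_square algebra_simps add_increasing)
  have "(frobenius_norm (cofactor3 M))\<^sup>2 = (hnorm (hcross (M $ 1) (M $ 2)))\<^sup>2
      + ((hnorm (hcross (M $ 2) (M $ 3)))\<^sup>2 + (hnorm (hcross (M $ 3) (M $ 1)))\<^sup>2)"
    by (simp add: frobenius_norm_power2 hnorm_power2 cofactor3_def sum_3)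
  also have "\<dots> \<le> (hnorm (M $ 1))\<^sup>2 * (hnorm (M $ 2))\<^sup>2
      + ((hnorm (M $ 2))\<^sup>2 * (hnorm (M $ 3))\<^sup>2 + (hnorm (M $ 3))\<^sup>2 * (hnorm (M $ 1))\<^sup>2)"
    by (intro add_mono rows)
  also have "\<dots> \<le> ((hnorm (M $ 1))\<^sup>2 + (hnorm (M $ 2))\<^sup>2 + (hnorm (M $ 3))\<^sup>2)\<^sup>2"
    by (rule sum_of_products) simp_all
  also have "(hnorm (M $ 1))\<^sup>2 + (hnorm (M $ 2))\<^sup>2 + (hnorm (M $ 3))\<^sup>2 = (frobenius_norm M)\<^sup>2"
    by (simp add: frobenius_norm_power2 hnorm_power2 sum_3)
  finally show "(frobenius_norm (cofactor3 M))\<^sup>2 \<le> ((frobenius_norm M)\<^sup>2)\<^sup>2" .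
qed simp

text \<open>A matrix whose determinant is not too small contracts neither points nor lines too much,
  since the two maps are inverse to each other up to transposition and the factor \<open>det M\<close>.\<close>

lemma hnorm_matrix_vector_ge:
  fixes M :: "hyperreal^3^3"
  shows "\<bar>det M\<bar> * hnorm x \<le> (frobenius_norm M)\<^sup>2 * hnorm (M *v x)"
proof -
  have "\<bar>det M\<bar> * hnorm x = hnorm (transpose (cofactor3 M) *v (M *v x))"
    by (simp only: cofactor3_transpose_mult hnorm_scale)
  also have "\<dots> \<le> frobenius_norm (cofactor3 M) * hnorm (M *v x)"
    using hnorm_matrix_vector_le[of "transpose (cofactor3 M)"]
    by (simp only: frobenius_norm_transpose)
  also have "\<dots> \<le> (frobenius_norm M)\<^sup>2 * hnorm (M *v x)"
    by (rule mult_right_mono[OF frobenius_norm_cofactor3_le hnorm_nonneg])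
  finally show ?thesis .
qed

lemma hnorm_cofactor3_vector_ge:
  "\<bar>det M\<bar> * hnorm y \<le> frobenius_norm M * hnorm (cofactor3 M *v y)"
proof -
  have "\<bar>det M\<bar> * hnorm y = hnorm (transpose M *v (cofactor3 M *v y))"
    by (simp only: transpose_cofactor3_mult hnorm_scale)
  also have "\<dots> \<le> frobenius_norm M * hnorm (cofactor3 M *v y)"
    using hnorm_matrix_vector_le[of "transpose M"] by (simp only: frobenius_norm_transpose)
  finally show ?thesis .
qed

section \<open>Almost incidence as an infinitesimal cosine\<close>

definition cosine :: "hyperreal^3 \<Rightarrow> hyperreal^3 \<Rightarrow> hyperreal" where
  "cosine x y = scalar_product x y / (hnorm x * hnorm y)"

lemma normalized_in_areps: "represents x P \<Longrightarrow> inverse (hnorm x) *s x \<in> areps P"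
  unfolding areps_def using self_in_mag[OF hnorm_nonzero] by (auto simp: represents_def)

lemma almost_incident_iff_cosine_infinitesimal:
  assumes "represents x P" "represents y l"
  shows "almost_incident P l \<longleftrightarrow> infinitesimal (cosine x y)"
  using almost_incident_iff[OF normalized_in_areps[OF assms(1)] normalized_in_areps[OF assms(2)]]
  by (simp add: scalar_product_scale cosine_def field_simps)

lemma represents_join:
  assumes "represents x P" "represents y Q" "P \<noteq> Q"
  shows "represents (hcross x y) (join P Q)"
proof -
  define c where "c = inverse (hnorm x) * inverse (hnorm y)"
  have "c \<noteq> 0"
    using assms(1,2) hnorm_nonzero by (auto simp: c_def represents_def)
  have "represents (c *s hcross x y) (join P Q)"
    using join_eq[OF assms(3) normalized_in_areps[OF assms(1)] normalized_in_areps[OF assms(2)]]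
    by (simp add: hcross_scale c_def)
  moreover have "hcross x y \<noteq> 0"
    using hcross_nonzero assms by blast
  ultimately show ?thesis
    using \<open>c \<noteq> 0\<close> abs_hproj_eq_iff[of "hcross x y" "c *s hcross x y"]
    unfolding represents_def by metis
qed

lemma transform_inject:
  assumes "invertible M" "transform M P = transform M Q"
  shows "P = Q"
proof -
  obtain x y where xy: "represents x P" "represents y Q"
    using represents_rep by blast
  obtain c where c: "c \<noteq> 0" "M *v y = c *s (M *v x)"
    using representsD[OF represents_transform[OF assms(1) xy(1)]]
      represents_transform[OF assms(1) xy(2)] assms(2) by metis
  then have "M *v y = M *v (c *s x)"
    by (simp add: vector_scalar_commute)
  then have "y = c *s x"
    using assms(1) by (metis invertible_def matrix_vector_mul_assoc matrix_vector_mul_lid)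
  then show ?thesis
    using xy c(1) abs_hproj_eq_iff[of x y] by (auto simp: represents_def)
qed

section \<open>Distortion of the cosine by a non-singular matrix\<close>

text \<open>The numerator contributes \<open>det M\<close>, the two factors of the denominator contribute
  \<open>\<parallel>M\<parallel>\<^sup>2 / \<bar>det M\<bar>\<close> and \<open>\<parallel>M\<parallel> / \<bar>det M\<bar>\<close>.\<close>

lemma cosine_transform_le:
  assumes "det M \<noteq> 0" "x \<noteq> 0" "y \<noteq> 0"
  shows "\<bar>cosine (M *v x) (cofactor3 M *v y)\<bar> \<le> frobenius_norm M ^ 3 / \<bar>det M\<bar> * \<bar>cosine x y\<bar>"
proof -
  let ?d = "\<bar>det M\<bar>" and ?s = "\<bar>scalar_product x y\<bar>" and ?f = "frobenius_norm M"
  let ?a = "hnorm x" and ?b = "hnorm y"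
  let ?a' = "hnorm (M *v x)" and ?b' = "hnorm (cofactor3 M *v y)"
  have "0 < ?d" "0 < ?a" "0 < ?b"
    using assms hnorm_pos by auto
  have "0 < ?f\<^sup>2 * ?a'" "0 < ?f * ?b'"
    using hnorm_matrix_vector_ge[of M x] hnorm_cofactor3_vector_ge[of M y]
      mult_pos_pos[OF \<open>0 < ?d\<close> \<open>0 < ?a\<close>] mult_pos_pos[OF \<open>0 < ?d\<close> \<open>0 < ?b\<close>]
    by linarith+
  then have pos: "0 < ?a'" "0 < ?b'"
    using hnorm_nonneg[of "M *v x"] hnorm_nonneg[of "cofactor3 M *v y"] by (auto simp: less_le)
  have "(?d * ?a) * (?d * ?b) \<le> (?f\<^sup>2 * ?a') * (?f * ?b')"
    by (intro mult_mono hnorm_matrix_vector_ge hnorm_cofactor3_vector_ge)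
      (simp_all add: hnorm_nonneg)
  then have "?d * ?d * (?a * ?b) \<le> ?f ^ 3 * (?a' * ?b')"
    by (simp add: power2_eq_square power3_eq_cube mult_ac)
  then have "?s * (?d * ?d * (?a * ?b)) \<le> ?s * (?f ^ 3 * (?a' * ?b'))"
    by (rule mult_left_mono) simp
  then have "?d * ?s / (?a' * ?b') \<le> ?f ^ 3 / ?d * (?s / (?a * ?b))"
    using \<open>0 < ?d\<close> \<open>0 < ?a\<close> \<open>0 < ?b\<close> pos by (simp add: divide_simps mult_ac)
  then show ?thesis
    by (simp add: cosine_def scalar_product_cofactor3 abs_mult hnorm_nonneg)
qed

text \<open>Up to sign, the distortion factor is the inverse of the determinant of the appreciable
  representative \<open>M / \<parallel>M\<parallel>\<close>.\<close>

lemma appreciable_distortion: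
  assumes "nonsingular M"
  shows "appreciable (frobenius_norm M ^ 3 / \<bar>det M\<bar>)"
proof -
  have "M \<noteq> 0"
    using assms by (simp add: nonsingular_def)
  let ?f = "frobenius_norm M"
  let ?N = "\<chi> i j. inverse ?f * M $ i $ j"
  have "?N \<in> mat_areps M"
    unfolding mat_areps_def using self_in_mag[OF frobenius_norm_nonzero[OF \<open>M \<noteq> 0\<close>]] by blast
  then have "appreciable (det ?N)"
    using nonsingular_iff[OF _ \<open>M \<noteq> 0\<close>] assms by blast
  moreover have "det ?N = inverse (?f ^ 3) * det M"
    by (simp add: det_3 power3_eq_cube algebra_simps)
  ultimately have "appreciable (inverse \<bar>inverse (?f ^ 3) * det M\<bar>)"
    using appreciable_inverse appreciable_abs by metis
  then show ?thesis
    using frobenius_norm_nonneg[of M] by (simp add: abs_mult divide_inverse mult.commute)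
qed

lemma infinitesimal_le: "\<bar>r\<bar> \<le> \<bar>s\<bar> \<Longrightarrow> infinitesimal s \<Longrightarrow> infinitesimal r"
  unfolding infinitesimal_def by (meson le_less_trans)

theorem lemma4p18:
  fixes p q r :: hproj and M :: "hyperreal^3^3"
  assumes "p \<noteq> q" and "p \<noteq> r" and "q \<noteq> r"
    and "almost_collinear p q r"
    and "invertible M"
    and "nonsingular M"
  shows "almost_collinear (transform M p) (transform M q) (transform M r)"
proof -
  obtain u v w where rep: "represents u p" "represents v q" "represents w r"
    using represents_rep by blast
  let ?l = "hcross v w"
  let ?c = "frobenius_norm M ^ 3 / \<bar>det M\<bar>"
  have line: "represents ?l (join q r)"
    using represents_join rep assms(3) by blast
  have line': "represents (cofactor3 M *v ?l) (join (transform M q) (transform M r))"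
    unfolding hcross_matrix_vector[symmetric]
    using represents_join represents_transform[OF assms(5)] rep transform_inject[OF assms(5)]
      assms(3) by blast
  have appr: "appreciable ?c"
    using appreciable_distortion[OF assms(6)] .
  have "infinitesimal (cosine u ?l)"
    using assms(4) almost_incident_iff_cosine_infinitesimal[OF rep(1) line]
    by (simp add: almost_collinear_def)
  then have "infinitesimal (?c * cosine u ?l)"
    by (rule infinitesimal_mult[OF appr])
  moreover have "\<bar>cosine (M *v u) (cofactor3 M *v ?l)\<bar> \<le> \<bar>?c * cosine u ?l\<bar>"
  proof -
    \<comment> \<open>Otherwise the quotient \<open>?c\<close> would be \<open>0\<close>, by the convention for division by zero.\<close>
    have "det M \<noteq> 0"
      using appreciable_nonzero[OF appr] by auto
    moreover have "u \<noteq> 0" "?l \<noteq> 0"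
      using rep(1) line by (auto simp: represents_def)
    ultimately show ?thesis
      using cosine_transform_le[of M u ?l] frobenius_norm_nonneg[of M] by (simp add: abs_mult)
  qed
  ultimately have "infinitesimal (cosine (M *v u) (cofactor3 M *v ?l))"
    using infinitesimal_le by blast
  then show ?thesis
    unfolding almost_collinear_def
    using almost_incident_iff_cosine_infinitesimal[OF represents_transform[OF assms(5) rep(1)] line']
    by blast
qed

end
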